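(* Let $G$ be a finite group acting transitively on a finite set $\Omega$ with $|\Omega|\geq 2$. Let $\mu$ be a probability distribution on $G$ and let $f:\Omega\to\mathbb{R}$ be a function that satisfies $\sum_{x\in\Omega}f(x)=0$. Then $$\|\mu\ast_c f\|^2\leq \frac{|G|}{d_H}\cdot\|\mu\|^2\cdot\|f\|^2.$$
   Context: Group actions are written on the left. $H$ is the stabilizer in $G$ of some element of $\Omega$; $1_H^G$ is the (complex) permutation representation of $G$ on the left cosets of $H$ (equivalently, on $\Omega$). $d_H$ is the minimum degree of a non-trivial irreducible component of $1_H^G$. A probability distribution over a finite set $\Lambda$ is a function $Z:\Lambda\to\mathbb{R}$ with $\sum_{\lambda\in\Lambda}Z(\lambda)=1$. The norm of $Z:\Lambda\to\mathbb{R}$ is $\|Z\|=\left(\sum_{\lambda\in\Lambda}Z(\lambda)^2\right)^{1/2}$. For $X:G\to\mathbb{R}$ and $Y:\Omega\to\mathbb{R}$, the convolution $X\ast_c Y:\Omega\to\mathbb{R}$ is $(X\ast_c Y)(\omega)=\sum_{g\in G}X(g)Y(g^{-1}\omega)$. *)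

theory Defs
  imports
    "HOL-Algebra.Group_Action"
    "HOL-Algebra.Left_Coset"
    "HOL-Analysis.L2_Norm"
    "HOL-Library.Function_Algebras"
begin

definition cscale :: "complex \<Rightarrow> ('y \<Rightarrow> complex) \<Rightarrow> 'y \<Rightarrow> complex" where
  "cscale c F = (\<lambda>y. c * F y)"

global_interpretation cfun: vector_space "cscale :: complex \<Rightarrow> ('y \<Rightarrow> complex) \<Rightarrow> 'y \<Rightarrow> complex"
  by unfold_locales (auto simp: cscale_def fun_eq_iff algebra_simps)

text \<open>
  A complex representation of \<open>G\<close> is given by a complex subspace \<open>V\<close> of some function space
  together with a linear action \<open>\<rho>\<close> of \<open>G\<close> on \<open>V\<close>. The notions below are only used for
  the permutation representation and its subrepresentations.
\<close>

definition subrepresentation ::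
    "('g, 'm) monoid_scheme \<Rightarrow> ('g \<Rightarrow> ('y \<Rightarrow> complex) \<Rightarrow> ('y \<Rightarrow> complex))
      \<Rightarrow> ('y \<Rightarrow> complex) set \<Rightarrow> ('y \<Rightarrow> complex) set \<Rightarrow> bool" where
  "subrepresentation G \<rho> V W \<longleftrightarrow>
     cfun.subspace W \<and> W \<subseteq> V \<and> (\<forall>g\<in>carrier G. \<forall>w\<in>W. \<rho> g w \<in> W)"

definition irreducible_rep ::
    "('g, 'm) monoid_scheme \<Rightarrow> ('g \<Rightarrow> ('y \<Rightarrow> complex) \<Rightarrow> ('y \<Rightarrow> complex))
      \<Rightarrow> ('y \<Rightarrow> complex) set \<Rightarrow> bool" where
  "irreducible_rep G \<rho> W \<longleftrightarrow>
     W \<noteq> {0} \<and> (\<forall>U. subrepresentation G \<rho> W U \<longrightarrow> U = {0} \<or> U = W)"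

text \<open>The trivial representation is the one-dimensional one on which \<open>G\<close> acts as the identity.\<close>

definition trivial_rep ::
    "('g, 'm) monoid_scheme \<Rightarrow> ('g \<Rightarrow> ('y \<Rightarrow> complex) \<Rightarrow> ('y \<Rightarrow> complex))
      \<Rightarrow> ('y \<Rightarrow> complex) set \<Rightarrow> bool" where
  "trivial_rep G \<rho> W \<longleftrightarrow> cfun.dim W = 1 \<and> (\<forall>g\<in>carrier G. \<forall>w\<in>W. \<rho> g w = w)"

text \<open>
  The functions \<open>E \<rightarrow> \<complex>\<close> are encoded as total functions vanishing outside \<open>E\<close>; then \<open>G\<close> acts
  by \<open>(g F)(x) = F(g\<^sup>-\<^sup>1 x)\<close>, i.e. \<open>g\<close> sends the indicator function of \<open>x\<close> to that of \<open>g x\<close>.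
\<close>

definition perm_space :: "'y set \<Rightarrow> ('y \<Rightarrow> complex) set" where
  "perm_space E = {F. \<forall>x. x \<notin> E \<longrightarrow> F x = 0}"

definition perm_rep ::
    "('g, 'm) monoid_scheme \<Rightarrow> 'y set \<Rightarrow> ('g \<Rightarrow> 'y \<Rightarrow> 'y)
      \<Rightarrow> 'g \<Rightarrow> ('y \<Rightarrow> complex) \<Rightarrow> ('y \<Rightarrow> complex)" where
  "perm_rep G E \<phi> g F = (\<lambda>x. if x \<in> E then F (\<phi> (inv\<^bsub>G\<^esub> g) x) else 0)"

definition coset_action ::
    "('g, 'm) monoid_scheme \<Rightarrow> 'g set \<Rightarrow> 'g \<Rightarrow> 'g set \<Rightarrow> 'g set" where
  "coset_action G H g = (\<lambda>C\<in>lcosets\<^bsub>G\<^esub> H. g <#\<^bsub>G\<^esub> C)"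

text \<open>
  \<open>irreducible_component G H W\<close>: \<open>W\<close> is an irreducible component of \<open>1\<^sub>H\<^sup>G\<close>. For a finite group,
  complete reducibility makes the irreducible constituents of a complex representation, up to
  isomorphism, exactly its irreducible subrepresentations.
\<close>

definition irreducible_component ::
    "('g, 'm) monoid_scheme \<Rightarrow> 'g set \<Rightarrow> ('g set \<Rightarrow> complex) set \<Rightarrow> bool" where
  "irreducible_component G H W \<longleftrightarrow>
     (let E = lcosets\<^bsub>G\<^esub> H; \<rho> = perm_rep G E (coset_action G H)
      in subrepresentation G \<rho> (perm_space E) W \<and> irreducible_rep G \<rho> W)"

text \<open>
  The number \<open>d\<^sub>H\<close>. It is meaningful when \<open>H\<close> is a proper subgroup of the finite group \<open>G\<close>, since
  then a non-trivial irreducible component exists.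
\<close>

definition min_nontrivial_degree :: "('g, 'm) monoid_scheme \<Rightarrow> 'g set \<Rightarrow> nat" where
  "min_nontrivial_degree G H =
     (LEAST d. \<exists>W. irreducible_component G H W
        \<and> \<not> trivial_rep G (perm_rep G (lcosets\<^bsub>G\<^esub> H) (coset_action G H)) W
        \<and> d = cfun.dim W)"

text \<open>Values are not required to be non-negative.\<close>

definition prob_distribution :: "'a set \<Rightarrow> ('a \<Rightarrow> real) \<Rightarrow> bool" where
  "prob_distribution \<Lambda> Z \<longleftrightarrow> (\<Sum>l\<in>\<Lambda>. Z l) = 1"

definition conv ::
    "('g, 'm) monoid_scheme \<Rightarrow> ('g \<Rightarrow> 'x \<Rightarrow> 'x) \<Rightarrow> ('g \<Rightarrow> real) \<Rightarrow> ('x \<Rightarrow> real) \<Rightarrow> 'x \<Rightarrow> real" where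
  "conv G \<phi> X Y \<omega> = (\<Sum>g\<in>carrier G. X g * Y (\<phi> (inv\<^bsub>G\<^esub> g) \<omega>))"

end

theory Submission
  imports Defs "HOL-Analysis.Function_Topology" "HOL-Analysis.Topology_Euclidean_Space"
    "HOL-Analysis.Convex"
begin

text \<open>
  For \<open>v\<close> in the space \<open>V\<close> of functions with sum zero put \<open>Q(w) = \<Sum>\<^sub>g |\<langle>g v, w\<rangle>|\<^sup>2\<close>, a \<open>G\<close>-invariant
  positive semidefinite Hermitian form on \<open>V\<close>. Its largest Rayleigh quotient \<open>L\<close> is attained exactly
  on a non-zero subrepresentation of \<open>V\<close>, which contains an irreducible \<open>W\<close>; by transitivity \<open>W\<close> is
  not trivial, so \<open>dim W \<ge> d\<^sub>H\<close>. Summing \<open>Q\<close> over an orthonormal basis of \<open>W\<close> and applying Bessel's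
  inequality to each \<open>g v\<close> gives \<open>L dim W \<le> |G| \<parallel>v\<parallel>\<^sup>2\<close>. Thus \<open>Q(w) \<le> (|G| / d\<^sub>H) \<parallel>v\<parallel>\<^sup>2 \<parallel>w\<parallel>\<^sup>2\<close>, and for
  \<open>w = \<mu> * v\<close> the theorem follows from \<open>\<parallel>w\<parallel>\<^sup>2 = \<Sum>\<^sub>g \<mu>(g) \<langle>g v, w\<rangle>\<close> and the Cauchy-Schwarz inequality.
  In this way neither Schur's lemma nor complete reducibility is needed.
\<close>

section \<open>Hermitian inner product, orthonormal families and dimension\<close>

definition cip :: "'y set \<Rightarrow> ('y \<Rightarrow> complex) \<Rightarrow> ('y \<Rightarrow> complex) \<Rightarrow> complex" where
  "cip E u w = (\<Sum>x\<in>E. u x * cnj (w x))"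

definition sqnorm :: "'y set \<Rightarrow> ('y \<Rightarrow> complex) \<Rightarrow> real" where
  "sqnorm E u = (\<Sum>x\<in>E. (cmod (u x))\<^sup>2)"

definition orthonormal :: "'y set \<Rightarrow> ('y \<Rightarrow> complex) set \<Rightarrow> bool" where
  "orthonormal E B \<longleftrightarrow> (\<forall>e\<in>B. \<forall>e'\<in>B. cip E e e' = (if e = e' then 1 else 0))"

lemma sum_fun_apply: "(\<Sum>i\<in>A. F i) x = (\<Sum>i\<in>A. F i x)"
  by (induction A rule: infinite_finite_induct) auto

lemma cip_self: "cip E u u = of_real (sqnorm E u)"
  by (simp add: cip_def sqnorm_def complex_norm_square del: of_real_power)

lemma cip_add_right: "cip E w (u + v) = cip E w u + cip E w v"
  and cip_diff_left: "cip E (u - v) w = cip E u w - cip E v w"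
  and cip_diff_right: "cip E w (u - v) = cip E w u - cip E w v"
  by (simp_all add: cip_def algebra_simps sum.distrib sum_subtractf)

lemma cip_scale_left: "cip E (cscale c u) w = c * cip E u w"
  and cip_scale_right: "cip E w (cscale c u) = cnj c * cip E w u"
  by (simp_all add: cip_def cscale_def sum_distrib_left mult_ac)

lemma cip_sum_left: "cip E (\<Sum>i\<in>A. F i) w = (\<Sum>i\<in>A. cip E (F i) w)"
  unfolding cip_def sum_fun_apply sum_distrib_right by (rule sum.swap)

lemma cip_sum_right: "cip E w (\<Sum>i\<in>A. F i) = (\<Sum>i\<in>A. cip E w (F i))"
  unfolding cip_def sum_fun_apply cnj_sum sum_distrib_left by (rule sum.swap)

lemma cip_commute: "cip E u w = cnj (cip E w u)"
  by (simp add: cip_def mult_ac)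

lemma sqnorm_nonneg: "0 \<le> sqnorm E u"
  by (simp add: sqnorm_def sum_nonneg)

lemma sqnorm_scale: "sqnorm E (cscale c u) = (cmod c)\<^sup>2 * sqnorm E u"
  by (simp add: sqnorm_def cscale_def sum_distrib_left norm_mult power_mult_distrib)

text \<open>Summation carries this law over to \<open>sqnorm\<close> and
  \<open>coeff_energy\<close>, the two forms compared when the maximizers of the Rayleigh quotient
  are shown to form a subspace.\<close>

lemma cmod_parallelogram:
  "(cmod (a + b))\<^sup>2 + (cmod (a - b))\<^sup>2 = 2 * (cmod a)\<^sup>2 + 2 * (cmod b)\<^sup>2"
  unfolding cmod_power2 by (simp add: power2_eq_square algebra_simps)

lemma sqnorm_parallelogram:
  "sqnorm E (u + w) + sqnorm E (u - w) = 2 * sqnorm E u + 2 * sqnorm E w"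
  by (simp add: sqnorm_def cmod_parallelogram sum_distrib_left flip: sum.distrib)

text \<open>\<open>sqnorm\<close> sees only the values on \<open>E\<close>, so definiteness comes
  from membership in \<open>perm_space E\<close>.\<close>

lemma sqnorm_pos:
  assumes "finite E" "u \<in> perm_space E" "u \<noteq> 0"
  shows "0 < sqnorm E u"
proof -
  obtain x where "u x \<noteq> 0" using assms(3) by (auto simp: fun_eq_iff)
  moreover from this have "x \<in> E" using assms(2) by (auto simp: perm_space_def)
  ultimately show ?thesis
    unfolding sqnorm_def using assms(1) by (intro sum_pos2[of _ x]) auto
qed

text \<open>Subtracting the orthogonal projection onto the span of \<open>B\<close> leaves a vector
  orthogonal to \<open>B\<close>. Both Bessel's inequality and the Gram-Schmidt step rest on
  this.\<close>

lemma cip_residual: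
  assumes "finite B" "orthonormal E B" "e \<in> B"
  shows "cip E (v - (\<Sum>b\<in>B. cscale (cip E v b) b)) e = 0"
proof -
  have "(\<Sum>b\<in>B. cip E v b * cip E b e) = (\<Sum>b\<in>B. if b = e then cip E v b else 0)"
    using assms by (intro sum.cong) (auto simp: orthonormal_def)
  then show ?thesis
    using assms by (simp add: cip_diff_left cip_sum_left cip_scale_left)
qed

text \<open>Pythagoras: the residual \<open>v - p\<close> is orthogonal to the projection
  \<open>p\<close>, so its squared norm, which is non-negative, is the difference of the two
  sides.\<close>

lemma bessel_inequality:
  assumes "finite B" "orthonormal E B"
  shows "(\<Sum>b\<in>B. (cmod (cip E v b))\<^sup>2) \<le> sqnorm E v"
proof -
  define p where "p = (\<Sum>b\<in>B. cscale (cip E v b) b)"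
  have "cip E (v - p) p = 0"
    using cip_residual[OF assms] by (simp add: p_def cip_sum_right cip_scale_right)
  then have "cip E (v - p) (v - p) = cip E v v - cip E p v"
    by (simp add: cip_diff_right cip_diff_left)
  also have "cip E p v = (\<Sum>b\<in>B. of_real ((cmod (cip E v b))\<^sup>2))"
    unfolding p_def cip_sum_left cip_scale_left
    by (intro sum.cong refl) (metis cip_commute complex_norm_square)
  finally have "complex_of_real (sqnorm E (v - p))
      = of_real (sqnorm E v - (\<Sum>b\<in>B. (cmod (cip E v b))\<^sup>2))"
    by (simp only: cip_self of_real_diff of_real_sum)
  then have "sqnorm E (v - p) = sqnorm E v - (\<Sum>b\<in>B. (cmod (cip E v b))\<^sup>2)"
    by (rule of_real_eq_iff[THEN iffD1])
  then show ?thesis using sqnorm_nonneg[of E "v - p"] by simp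
qed

text \<open>Gram-Schmidt, one vector at a time; allowing every \<open>n\<close> up to the dimension
  makes the induction go through.\<close>

lemma orthonormal_subset_of_dim:
  assumes "finite E" "cfun.subspace W" "W \<subseteq> perm_space E" "n \<le> cfun.dim W"
  shows "\<exists>B. finite B \<and> B \<subseteq> W \<and> orthonormal E B \<and> card B = n"
  using assms(4)
proof (induction n)
  case 0
  show ?case by (rule exI[of _ "{}"]) (simp add: orthonormal_def)
next
  case (Suc n)
  then obtain B where B: "finite B" "B \<subseteq> W" "orthonormal E B" "card B = n"
    by auto
  \<comment> \<open>Fewer than \<open>cfun.dim W\<close> vectors cannot span \<open>W\<close>. The
    normalized residual of a vector outside their span is the next member of the family.\<close>
  have "\<not> W \<subseteq> cfun.span B"
    using cfun.dim_le_card[of W B] B Suc.prems by auto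
  then obtain w where w: "w \<in> W" "w \<notin> cfun.span B" by auto
  define p where "p = (\<Sum>b\<in>B. cscale (cip E w b) b)"
  define r where "r = w - p"
  have "p \<in> cfun.span B"
    unfolding p_def by (intro cfun.span_sum cfun.span_scale cfun.span_base)
  moreover have "cfun.span B \<subseteq> W"
    using B(2) assms(2) by (rule cfun.span_minimal)
  ultimately have r: "r \<in> W" "r \<noteq> 0"
    using w assms(2) unfolding r_def by (auto intro: cfun.subspace_diff)
  then have pos: "0 < sqnorm E r"
    using assms by (intro sqnorm_pos) auto
  define e where "e = cscale (of_real (1 / sqrt (sqnorm E r))) r"
  have e_self: "cip E e e = 1"
    using pos by (simp add: cip_self e_def sqnorm_scale norm_divide power_divide)
  have e_orth: "cip E e b = 0" if "b \<in> B" for b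
    using cip_residual[OF B(1,3) that, of w]
    by (simp add: e_def cip_scale_left r_def p_def)
  have e_orth': "cip E b e = 0" if "b \<in> B" for b
    using e_orth[OF that] cip_commute[of E b e] by simp
  have "e \<notin> B" using e_self e_orth by auto
  moreover have "orthonormal E (insert e B)"
    using B(3) e_self e_orth e_orth' \<open>e \<notin> B\<close>
    by (auto simp: orthonormal_def)
  moreover have "e \<in> W"
    unfolding e_def using r assms(2) by (intro cfun.subspace_scale)
  ultimately show ?case using B by (intro exI[of _ "insert e B"]) auto
qed

text \<open>The full function type may be infinite-dimensional; finiteness comes from the indicator
  functions of the points of \<open>E\<close>, which span \<open>perm_space E\<close>.\<close>

lemma finite_if_independent_perm_space:
  assumes "finite E" "B \<subseteq> perm_space E" "cfun.independent B"
  shows "finite B"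
proof -
  define \<delta> :: "'a \<Rightarrow> 'a \<Rightarrow> complex" where "\<delta> x = (\<lambda>y. if y = x then 1 else 0)" for x
  have "F \<in> cfun.span (\<delta> ` E)" if "F \<in> perm_space E" for F
  proof -
    have "F = (\<Sum>x\<in>E. cscale (F x) (\<delta> x))"
    proof (rule ext)
      fix y
      have "(\<Sum>x\<in>E. cscale (F x) (\<delta> x)) y = (\<Sum>x\<in>E. if y = x then F x else 0)"
        unfolding sum_fun_apply by (intro sum.cong) (auto simp: cscale_def \<delta>_def)
      then show "F y = (\<Sum>x\<in>E. cscale (F x) (\<delta> x)) y"
        using that assms(1) by (simp add: perm_space_def)
    qed
    also have "\<dots> \<in> cfun.span (\<delta> ` E)"
      by (intro cfun.span_sum cfun.span_scale cfun.span_base) auto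
    finally show ?thesis .
  qed
  then show ?thesis
    using cfun.independent_span_bound[of "\<delta> ` E" B] assms by blast
qed

text \<open>A basis of \<open>U\<close> together with a vector of \<open>W\<close> outside
  \<open>U\<close> is still independent, and it lies in the span of a finite basis of
  \<open>W\<close>.\<close>

lemma dim_less_of_psubset:
  assumes "finite E" "cfun.subspace U" "cfun.subspace W" "U \<subset> W" "W \<subseteq> perm_space E"
  shows "cfun.dim U < cfun.dim W"
proof -
  obtain B where B: "B \<subseteq> U" "cfun.independent B" "U \<subseteq> cfun.span B" "card B = cfun.dim U"
    using cfun.basis_exists .
  obtain C where C: "C \<subseteq> W" "cfun.independent C" "W \<subseteq> cfun.span C" "card C = cfun.dim W"
    using cfun.basis_exists .
  have "B \<subseteq> perm_space E" "C \<subseteq> perm_space E"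
    using B(1) C(1) assms(4,5) by auto
  then have "finite C" "finite B"
    using finite_if_independent_perm_space[OF assms(1)] B(2) C(2) by simp_all
  obtain w where w: "w \<in> W" "w \<notin> U" using assms(4) by auto
  have "cfun.span B \<subseteq> U" using B(1) assms(2) by (rule cfun.span_minimal)
  with w have wB: "w \<notin> cfun.span B" by auto
  then have "cfun.independent (insert w B)"
    using B(2) by (rule cfun.independent_insertI)
  moreover have "w \<notin> B"
    using w(2) B(1) by auto
  moreover have "insert w B \<subseteq> cfun.span C"
    using w B C assms(4) by auto
  ultimately have "card (insert w B) \<le> card C"
    using cfun.independent_span_bound[OF \<open>finite C\<close>] by simp
  then show ?thesis using \<open>w \<notin> B\<close> \<open>finite B\<close> B C by simp
qed

section \<open>Functions with sum zero and maximization of Rayleigh quotients\<close>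

text \<open>Within \<open>perm_space E\<close> this is the orthogonal complement of the functions
  constant on \<open>E\<close>.\<close>

definition zero_sum_space :: "'y set \<Rightarrow> ('y \<Rightarrow> complex) set" where
  "zero_sum_space E = {F \<in> perm_space E. (\<Sum>x\<in>E. F x) = 0}"

lemma subspace_zero_sum_space: "cfun.subspace (zero_sum_space E)"
  by (rule cfun.subspaceI)
    (auto simp: zero_sum_space_def perm_space_def cscale_def sum.distrib simp flip: sum_distrib_left)

text \<open>In the product topology the sphere is a closed part of a product of closed unit discs
  (over \<open>E\<close>) and points \<open>{0}\<close> (elsewhere), which is compact by Tychonoff's
  theorem.\<close>

lemma compact_unit_sphere_zero_sum_space:
  assumes "finite E"
  shows "compact {F \<in> zero_sum_space E. sqnorm E F = 1}"
proof -
  define S :: "('a \<Rightarrow> complex) set"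
    where "S = PiE UNIV (\<lambda>x. if x \<in> E then cball (0::complex) 1 else {0})"
  have "compactin (product_topology (\<lambda>_. euclidean) UNIV) S"
    unfolding S_def by (subst compactin_PiE) auto
  then have "compact S"
    by (simp add: euclidean_product_topology)
  have cont: "continuous_on UNIV (\<lambda>F::'a \<Rightarrow> complex. F x)" for x
    by simp
  have "closed {F. (\<Sum>x\<in>E. F x) = (0::complex)}"
    by (intro closed_Collect_eq continuous_intros cont)
  moreover have "closed {F. sqnorm E F = 1}"
    unfolding sqnorm_def by (intro closed_Collect_eq continuous_intros cont)
  ultimately have compact_S: "compact (S \<inter> ({F. (\<Sum>x\<in>E. F x) = 0} \<inter> {F. sqnorm E F = 1}))"
    using \<open>compact S\<close> by (intro compact_Int_closed closed_Int)
  have "cmod (F x) \<le> 1" if "sqnorm E F = 1" "x \<in> E" for F x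
  proof -
    have "(cmod (F x))\<^sup>2 \<le> sqnorm E F"
      unfolding sqnorm_def using assms that by (intro member_le_sum) auto
    then show ?thesis using that by (simp add: power_le_one_iff)
  qed
  then have "{F \<in> zero_sum_space E. sqnorm E F = 1} \<subseteq> S"
    by (auto simp: S_def zero_sum_space_def perm_space_def)
  moreover have "S \<subseteq> perm_space E"
    by (auto simp: S_def perm_space_def PiE_iff split: if_splits)
  ultimately have "S \<inter> ({F. (\<Sum>x\<in>E. F x) = 0} \<inter> {F. sqnorm E F = 1})
      = {F \<in> zero_sum_space E. sqnorm E F = 1}"
    unfolding zero_sum_space_def by blast
  with compact_S show ?thesis by simp
qed

text \<open>Homogeneity reduces the quotient to the unit sphere, where the continuous
  \<open>Q\<close> attains its supremum; \<open>u\<close> shows that this sphere is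
  non-empty.\<close>

lemma exists_rayleigh_maximizer:
  assumes "finite E" "u \<in> zero_sum_space E" "u \<noteq> 0"
    and cont: "continuous_on UNIV Q"
    and scale: "\<And>c w. Q (cscale c w) = (cmod c)\<^sup>2 * Q w"
  shows "\<exists>w0\<in>zero_sum_space E. sqnorm E w0 = 1
           \<and> (\<forall>w\<in>zero_sum_space E. Q w \<le> Q w0 * sqnorm E w)"
proof -
  let ?K = "{F \<in> zero_sum_space E. sqnorm E F = 1}"
  define nz where "nz w = cscale (of_real (1 / sqrt (sqnorm E w))) w" for w
  have pos: "0 < sqnorm E w" if "w \<in> zero_sum_space E" "w \<noteq> 0" for w
    using that assms(1) by (intro sqnorm_pos) (auto simp: zero_sum_space_def)
  have nz: "nz w \<in> ?K" "Q w = Q (nz w) * sqnorm E w"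
    if "w \<in> zero_sum_space E" "w \<noteq> 0" for w
  proof -
    have "nz w \<in> zero_sum_space E"
      unfolding nz_def using subspace_zero_sum_space that(1) by (rule cfun.subspace_scale)
    then show "nz w \<in> ?K" "Q w = Q (nz w) * sqnorm E w"
      using pos[OF that] by (simp_all add: nz_def sqnorm_scale scale norm_divide power_divide)
  qed
  have "compact ?K" using assms(1) by (rule compact_unit_sphere_zero_sum_space)
  moreover have "?K \<noteq> {}" using nz(1)[OF assms(2,3)] by blast
  moreover have "continuous_on ?K Q"
    using cont by (rule continuous_on_subset) simp
  ultimately obtain w0 where w0: "w0 \<in> ?K" "\<And>w. w \<in> ?K \<Longrightarrow> Q w \<le> Q w0"
    using continuous_attains_sup[of ?K Q] by blast
  have "Q w \<le> Q w0 * sqnorm E w" if "w \<in> zero_sum_space E" for w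
  proof (cases "w = 0")
    case True
    \<comment> \<open>Writing the zero vector as a multiple by 0 lets \<open>scale\<close> yield
      \<open>Q w = 0\<close>.\<close>
    then have "cscale 0 w = w" by (simp add: cscale_def fun_eq_iff)
    then show ?thesis
      using scale[of 0 w] sqnorm_scale[of E 0 w] by simp
  next
    case False
    show ?thesis
      using nz(2)[OF that False] w0(2)[OF nz(1)[OF that False]] sqnorm_nonneg[of E w]
      by (simp add: mult_right_mono)
  qed
  then show ?thesis using w0(1) by blast
qed

text \<open>
  The maximizers are the zeros of the non-negative form \<open>L \<parallel>w\<parallel>\<^sup>2 - Q w\<close>; the parallelogram law shows
  that they are closed under addition.
\<close>

lemma subspace_rayleigh_maximizers:
  assumes V: "cfun.subspace V"
    and scale: "\<And>c w. Q (cscale c w) = (cmod c)\<^sup>2 * Q w"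
    and parallelogram: "\<And>u w. Q (u + w) + Q (u - w) = 2 * Q u + 2 * Q w"
    and bound: "\<And>w. w \<in> V \<Longrightarrow> Q w \<le> L * sqnorm E w"
  shows "cfun.subspace {w \<in> V. Q w = L * sqnorm E w}"
proof (rule cfun.subspaceI)
  have "Q (cscale 0 0) = L * sqnorm E (cscale 0 0)"
    unfolding scale sqnorm_scale by simp
  moreover have "cscale 0 0 = (0 :: 'a \<Rightarrow> complex)"
    by (simp add: cscale_def fun_eq_iff)
  ultimately have "Q 0 = L * sqnorm E 0" by (simp only:)
  then show "0 \<in> {w \<in> V. Q w = L * sqnorm E w}"
    using V by (simp only: mem_Collect_eq cfun.subspace_0)
next
  fix u w assume uw: "u \<in> {w \<in> V. Q w = L * sqnorm E w}" "w \<in> {w \<in> V. Q w = L * sqnorm E w}"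
  then have V': "u + w \<in> V" "u - w \<in> V"
    using cfun.subspace_add[OF V] cfun.subspace_diff[OF V] by simp_all
  have "Q (u + w) + Q (u - w) = L * (sqnorm E (u + w) + sqnorm E (u - w))"
    using uw unfolding parallelogram sqnorm_parallelogram by (simp add: algebra_simps)
  then have "Q (u + w) = L * sqnorm E (u + w)"
    using bound[OF V'(1)] bound[OF V'(2)] unfolding distrib_left by linarith
  with V' show "u + w \<in> {w \<in> V. Q w = L * sqnorm E w}" by blast
next
  fix c w assume "w \<in> {w \<in> V. Q w = L * sqnorm E w}"
  then show "cscale c w \<in> {w \<in> V. Q w = L * sqnorm E w}"
    using cfun.subspace_scale[OF V] by (simp add: scale sqnorm_scale)
qed

section \<open>Irreducible subrepresentations\<close>

text \<open>A non-zero subrepresentation inside \<open>U\<close> of least dimension is irreducible,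
  since a proper non-zero one inside it would have smaller dimension.\<close>

lemma subrepresentation_contains_irreducible:
  assumes "finite E" "subrepresentation G \<rho> (perm_space E) U" "U \<noteq> {0}"
  shows "\<exists>W\<subseteq>U. subrepresentation G \<rho> (perm_space E) W \<and> irreducible_rep G \<rho> W"
proof -
  define P where "P W \<longleftrightarrow> W \<subseteq> U \<and> W \<noteq> {0} \<and> subrepresentation G \<rho> (perm_space E) W" for W
  have "P U" using assms by (simp add: P_def)
  then obtain W where W: "P W" and minW: "\<And>W'. P W' \<Longrightarrow> cfun.dim W \<le> cfun.dim W'"
    using ex_has_least_nat[of P U cfun.dim] by metis
  have subW: "cfun.subspace W" "W \<subseteq> perm_space E"
    using W by (simp_all add: P_def subrepresentation_def)
  have "U' = W" if U': "subrepresentation G \<rho> W U'" "U' \<noteq> {0}" for U'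
  proof (rule ccontr)
    assume "U' \<noteq> W"
    then have sub: "cfun.subspace U'" "U' \<subset> W"
      using U'(1) by (simp_all add: subrepresentation_def psubset_eq)
    then have "P U'"
      using U' W by (simp add: P_def subrepresentation_def subset_trans[of U' W])
    then show False
      using minW dim_less_of_psubset[OF assms(1) sub(1) subW(1) sub(2) subW(2)]
      by (simp add: leD)
  qed
  then have "irreducible_rep G \<rho> W"
    using W by (auto simp: irreducible_rep_def P_def)
  then show ?thesis using W unfolding P_def by blast
qed

text \<open>This makes the minimal degree positive, so that the final division by it is a genuine
  one.\<close>

lemma irreducible_rep_dim_pos:
  assumes "finite E" "subrepresentation G \<rho> (perm_space E) W" "irreducible_rep G \<rho> W"
  shows "0 < cfun.dim W"
proof -
  have W: "cfun.subspace W" "W \<subseteq> perm_space E" "W \<noteq> {0}"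
    using assms by (simp_all add: subrepresentation_def irreducible_rep_def)
  then have "{0} \<subset> W" using cfun.subspace_0[OF W(1)] by auto
  from dim_less_of_psubset[OF assms(1) cfun.subspace_single_0 W(1) this W(2)]
  show ?thesis by (rule le_less_trans[OF le0])
qed

section \<open>The energy form and its invariance under the group\<close>

text \<open>The analogue of \<open>min_nontrivial_degree\<close> for an arbitrary action, which lets
  the analytic argument run on a general set \<open>E\<close>; the coset action gives back
  \<open>min_nontrivial_degree\<close>.\<close>

definition min_degree :: "('g, 'm) monoid_scheme \<Rightarrow> 'y set \<Rightarrow> ('g \<Rightarrow> 'y \<Rightarrow> 'y) \<Rightarrow> nat" where
  "min_degree G E \<phi> =
     (LEAST d. \<exists>W. subrepresentation G (perm_rep G E \<phi>) (perm_space E) W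
        \<and> irreducible_rep G (perm_rep G E \<phi>) W \<and> \<not> trivial_rep G (perm_rep G E \<phi>) W
        \<and> d = cfun.dim W)"

text \<open>The form \<open>Q\<close> of the overview: the squared moduli of the matrix coefficients
  of the permutation representation, with \<open>v\<close> as a fixed parameter.\<close>

definition coeff_energy ::
    "('g, 'm) monoid_scheme \<Rightarrow> 'y set \<Rightarrow> ('g \<Rightarrow> 'y \<Rightarrow> 'y)
      \<Rightarrow> ('y \<Rightarrow> complex) \<Rightarrow> ('y \<Rightarrow> complex) \<Rightarrow> real" where
  "coeff_energy G E \<phi> v w = (\<Sum>g\<in>carrier G. (cmod (cip E (perm_rep G E \<phi> g v) w))\<^sup>2)"

lemma coeff_energy_scale:
  "coeff_energy G E \<phi> v (cscale c w) = (cmod c)\<^sup>2 * coeff_energy G E \<phi> v w"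
  by (simp add: coeff_energy_def cip_scale_right norm_mult power_mult_distrib sum_distrib_left)

lemma coeff_energy_parallelogram:
  "coeff_energy G E \<phi> v (u + w) + coeff_energy G E \<phi> v (u - w)
     = 2 * coeff_energy G E \<phi> v u + 2 * coeff_energy G E \<phi> v w"
  unfolding coeff_energy_def cip_add_right cip_diff_right
  by (simp only: cmod_parallelogram sum_distrib_left flip: sum.distrib)

lemma continuous_coeff_energy:
  fixes v :: "'y \<Rightarrow> complex"
  shows "continuous_on UNIV (coeff_energy G E \<phi> v)"
proof -
  have coord: "continuous_on UNIV (\<lambda>w::'y \<Rightarrow> complex. w x)" for x by simp
  show ?thesis
    unfolding coeff_energy_def cip_def by (intro continuous_intros coord)
qed

context group_action
begin

lemma group_G: "group G"
  using group_hom group_hom.axioms(1) by blast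

lemma bij_betw_action: "g \<in> carrier G \<Longrightarrow> bij_betw (\<phi> g) E E"
  using bij_prop0 by (auto simp: Bij_def)

lemma cip_perm_rep:
  assumes "g \<in> carrier G"
  shows "cip E (perm_rep G E \<phi> g u) (perm_rep G E \<phi> g w) = cip E u w"
proof -
  interpret group G by (rule group_G)
  have "cip E (perm_rep G E \<phi> g u) (perm_rep G E \<phi> g w)
      = (\<Sum>x\<in>E. u (\<phi> (inv g) x) * cnj (w (\<phi> (inv g) x)))"
    by (simp add: cip_def perm_rep_def)
  also have "\<dots> = cip E u w"
    unfolding cip_def using assms
    by (intro sum.reindex_bij_betw[where g = "\<lambda>x. u x * cnj (w x)"] bij_betw_action) simp
  finally show ?thesis .
qed

lemma sqnorm_perm_rep: "g \<in> carrier G \<Longrightarrow> sqnorm E (perm_rep G E \<phi> g u) = sqnorm E u"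
  using cip_perm_rep[of g u u] by (simp only: cip_self of_real_eq_iff)

lemma perm_rep_mult:
  assumes "g \<in> carrier G" "h \<in> carrier G"
  shows "perm_rep G E \<phi> (g \<otimes> h) u = perm_rep G E \<phi> g (perm_rep G E \<phi> h u)"
proof -
  interpret group G by (rule group_G)
  \<comment> \<open>\<open>perm_rep\<close> cuts off outside \<open>E\<close>; this shows that the
    inner cut-off has no effect at points of \<open>E\<close>.\<close>
  have "\<phi> (inv g) x \<in> E" if "x \<in> E" for x
    using that assms element_image by blast
  then show ?thesis
    using assms by (auto simp: perm_rep_def fun_eq_iff inv_mult_group composition_rule)
qed

lemma perm_rep_zero_sum_space:
  assumes "g \<in> carrier G" "w \<in> zero_sum_space E"
  shows "perm_rep G E \<phi> g w \<in> zero_sum_space E"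
proof -
  interpret group G by (rule group_G)
  have "(\<Sum>x\<in>E. w (\<phi> (inv g) x)) = (\<Sum>x\<in>E. w x)"
    using assms by (intro sum.reindex_bij_betw bij_betw_action) simp
  then show ?thesis
    using assms by (simp add: zero_sum_space_def perm_space_def perm_rep_def)
qed

text \<open>Replace the summation index \<open>g\<close> by \<open>h \<otimes> g\<close> and cancel
  \<open>h\<close> by unitarity. Hence the set of maximizers is stable under
  \<open>G\<close>.\<close>

lemma coeff_energy_perm_rep:
  assumes "h \<in> carrier G"
  shows "coeff_energy G E \<phi> v (perm_rep G E \<phi> h w) = coeff_energy G E \<phi> v w"
proof -
  interpret group G by (rule group_G)
  have "coeff_energy G E \<phi> v (perm_rep G E \<phi> h w)
      = (\<Sum>g\<in>carrier G. (cmod (cip E (perm_rep G E \<phi> (h \<otimes> g) v) (perm_rep G E \<phi> h w)))\<^sup>2)"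
    unfolding coeff_energy_def
  proof (rule sum.reindex_bij_betw[symmetric])
    show "bij_betw (\<lambda>g. h \<otimes> g) (carrier G) (carrier G)"
      using assms inj_on_cmult surj_const_mult by (auto simp: bij_betw_def)
  qed
  then show ?thesis
    using assms by (simp add: coeff_energy_def perm_rep_mult cip_perm_rep)
qed

text \<open>Bessel's inequality applies to each translate of \<open>v\<close>, and all translates
  have the norm of \<open>v\<close>; the number of translates yields the factor
  \<open>order G\<close>.\<close>

lemma sum_coeff_energy_le:
  assumes "finite B" "orthonormal E B"
  shows "(\<Sum>b\<in>B. coeff_energy G E \<phi> v b) \<le> real (order G) * sqnorm E v"
proof -
  have "(\<Sum>b\<in>B. coeff_energy G E \<phi> v b)
      = (\<Sum>g\<in>carrier G. \<Sum>b\<in>B. (cmod (cip E (perm_rep G E \<phi> g v) b))\<^sup>2)"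
    unfolding coeff_energy_def by (rule sum.swap)
  also have "\<dots> \<le> (\<Sum>g\<in>carrier G. sqnorm E v)"
  proof (rule sum_mono)
    fix g assume "g \<in> carrier G"
    then show "(\<Sum>b\<in>B. (cmod (cip E (perm_rep G E \<phi> g v) b))\<^sup>2) \<le> sqnorm E v"
      using bessel_inequality[OF assms] sqnorm_perm_rep by metis
  qed
  also have "\<dots> = real (order G) * sqnorm E v"
    by (simp add: order_def)
  finally show ?thesis .
qed

end

section \<open>The bound for a transitive action\<close>

context transitive_action
begin

text \<open>By transitivity a fixed vector is constant on \<open>E\<close>, so its sum is
  \<open>card E\<close> times its value, which vanishes only for the zero vector.\<close>

lemma not_trivial_rep_if_zero_sum:
  assumes "finite E" "W \<subseteq> zero_sum_space E" "w \<in> W" "w \<noteq> 0"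
  shows "\<not> trivial_rep G (perm_rep G E \<phi>) W"
proof
  assume triv: "trivial_rep G (perm_rep G E \<phi>) W"
  interpret group G by (rule group_G)
  have w: "\<And>x. x \<notin> E \<Longrightarrow> w x = 0" "(\<Sum>x\<in>E. w x) = 0"
    using assms by (auto simp: zero_sum_space_def perm_space_def)
  obtain x where x: "w x \<noteq> 0" using assms(4) by (auto simp: fun_eq_iff)
  then have "x \<in> E" using w(1) by blast
  have "w y = w x" if y: "y \<in> E" for y
  proof -
    obtain g where g: "g \<in> carrier G" "\<phi> g x = y"
      using unique_orbit \<open>x \<in> E\<close> y by blast
    have "perm_rep G E \<phi> g w y = w y"
      using triv g(1) assms(3) by (simp add: trivial_rep_def)
    moreover have "\<phi> (inv g) y = x"
      using orbit_sym_aux[OF g(1) \<open>x \<in> E\<close> g(2)] .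
    ultimately show ?thesis using y by (simp add: perm_rep_def)
  qed
  then have "(\<Sum>y\<in>E. w y) = of_nat (card E) * w x" by simp
  then show False
    using w(2) x assms(1) \<open>x \<in> E\<close> by auto
qed

text \<open>Both claims come from one irreducible \<open>W\<close> inside the maximizers;
  \<open>u\<close> only witnesses that the space of zero-sum functions is non-zero.\<close>

lemma coeff_energy_le:
  assumes "finite E" "u \<in> zero_sum_space E" "u \<noteq> 0"
  shows "0 < min_degree G E \<phi>"
    and "w \<in> zero_sum_space E \<Longrightarrow> real (min_degree G E \<phi>) * coeff_energy G E \<phi> v w
           \<le> real (order G) * sqnorm E v * sqnorm E w"
proof -
  let ?\<rho> = "perm_rep G E \<phi>" and ?Q = "coeff_energy G E \<phi> v"
  obtain w0 where w0: "w0 \<in> zero_sum_space E" "sqnorm E w0 = 1"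
    and max: "\<And>w. w \<in> zero_sum_space E \<Longrightarrow> ?Q w \<le> ?Q w0 * sqnorm E w"
    using exists_rayleigh_maximizer[OF assms continuous_coeff_energy coeff_energy_scale] by metis
  \<comment> \<open>This is the top eigenspace of the form \<open>?Q\<close>, described through its
    Rayleigh quotient.\<close>
  define U where "U = {w \<in> zero_sum_space E. ?Q w = ?Q w0 * sqnorm E w}"
  have "cfun.subspace U"
    unfolding U_def using subspace_zero_sum_space coeff_energy_scale coeff_energy_parallelogram max
    by (rule subspace_rayleigh_maximizers)
  then have "subrepresentation G ?\<rho> (perm_space E) U"
    by (auto simp: subrepresentation_def U_def perm_rep_zero_sum_space coeff_energy_perm_rep
        sqnorm_perm_rep) (auto simp: zero_sum_space_def)
  moreover have "w0 \<in> U" "w0 \<noteq> 0"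
    using w0 by (auto simp: U_def sqnorm_def)
  ultimately obtain W where W: "W \<subseteq> U" "subrepresentation G ?\<rho> (perm_space E) W"
      "irreducible_rep G ?\<rho> W"
    using subrepresentation_contains_irreducible[OF assms(1)] by blast
  have WS: "cfun.subspace W" "W \<noteq> {0}" "W \<subseteq> perm_space E"
    using W by (auto simp: subrepresentation_def irreducible_rep_def)
  then obtain w1 where "w1 \<in> W" "w1 \<noteq> 0" using cfun.subspace_0 by blast
  then have nontriv: "\<not> trivial_rep G ?\<rho> W"
    using W(1) assms(1) by (intro not_trivial_rep_if_zero_sum) (auto simp: U_def)
  let ?P = "\<lambda>d. \<exists>W. subrepresentation G ?\<rho> (perm_space E) W \<and> irreducible_rep G ?\<rho> W
        \<and> \<not> trivial_rep G ?\<rho> W \<and> d = cfun.dim W"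
  \<comment> \<open>The witness \<open>W\<close> ensures that the \<open>LEAST\<close> in
    \<open>min_degree\<close> is attained by an actual representation.\<close>
  have PW: "?P (cfun.dim W)" using W nontriv by blast
  then have "?P (min_degree G E \<phi>)"
    unfolding min_degree_def by (rule LeastI)
  then show "0 < min_degree G E \<phi>"
    using irreducible_rep_dim_pos[OF assms(1)] by metis
  have deg: "min_degree G E \<phi> \<le> cfun.dim W"
    unfolding min_degree_def using PW by (rule Least_le)
  obtain B where B: "finite B" "B \<subseteq> W" "orthonormal E B" "card B = cfun.dim W"
    using orthonormal_subset_of_dim[OF assms(1) WS(1,3) order_refl] by blast
  have "?Q b = ?Q w0" if "b \<in> B" for b
  proof -
    have "cip E b b = 1" using B(3) that by (simp add: orthonormal_def)
    then have "sqnorm E b = 1" by (simp add: cip_self)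
    then show ?thesis using that B(2) W(1) by (auto simp: U_def)
  qed
  \<comment> \<open>Every unit vector of \<open>W\<close> has the maximal energy, so the sum over an
    orthonormal basis is a multiple of the maximum.\<close>
  then have "real (cfun.dim W) * ?Q w0 = (\<Sum>b\<in>B. ?Q b)"
    using B(4) by simp
  also have "\<dots> \<le> real (order G) * sqnorm E v"
    using B(1,3) by (rule sum_coeff_energy_le)
  finally have dimW: "real (cfun.dim W) * ?Q w0 \<le> real (order G) * sqnorm E v" .
  have "0 \<le> ?Q w0" by (simp add: coeff_energy_def sum_nonneg)
  then have "real (min_degree G E \<phi>) * ?Q w0 \<le> real (cfun.dim W) * ?Q w0"
    using deg by (intro mult_right_mono) auto
  then have bound: "real (min_degree G E \<phi>) * ?Q w0 \<le> real (order G) * sqnorm E v"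
    using dimW by linarith
  show "real (min_degree G E \<phi>) * ?Q w \<le> real (order G) * sqnorm E v * sqnorm E w"
    if w: "w \<in> zero_sum_space E"
  proof -
    have "real (min_degree G E \<phi>) * ?Q w \<le> real (min_degree G E \<phi>) * (?Q w0 * sqnorm E w)"
      using max[OF w] by (intro mult_left_mono) auto
    also have "\<dots> \<le> real (order G) * sqnorm E v * sqnorm E w"
      using mult_right_mono[OF bound sqnorm_nonneg[of E w]] by (simp add: mult_ac)
    finally show ?thesis .
  qed
qed

text \<open>The energy bound is used with \<open>f\<close> as \<open>v\<close> and the convolution
  as \<open>w\<close>. Cauchy-Schwarz gives the fourth power of the norm of the convolution on the
  left, and its square cancels.\<close>

theorem conv_L2_bound:
  assumes finG: "finite (carrier G)" and finE: "finite E" and sum0: "(\<Sum>x\<in>E. f x) = 0"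
  shows "(L2_set (conv G \<phi> \<mu> f) E)\<^sup>2
    \<le> real (order G) / real (min_degree G E \<phi>) * (L2_set \<mu> (carrier G))\<^sup>2 * (L2_set f E)\<^sup>2"
proof -
  interpret group G by (rule group_G)
  define c where "c = conv G \<phi> \<mu> f"
  \<comment> \<open>The real functions may take any values outside \<open>E\<close>; their complex
    versions are cut off there so as to lie in \<open>perm_space E\<close>.\<close>
  define v where "v = (\<lambda>x. if x \<in> E then complex_of_real (f x) else 0)"
  define w where "w = (\<lambda>x. if x \<in> E then complex_of_real (c x) else 0)"
  define t where "t g = (\<Sum>x\<in>E. f (\<phi> (inv g) x) * c x)" for g
  have L2: "(L2_set h A)\<^sup>2 = (\<Sum>x\<in>A. (h x)\<^sup>2)" for h :: "'z \<Rightarrow> real" and A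
    by (simp add: L2_set_def sum_nonneg)
  have sum_shift: "(\<Sum>x\<in>E. f (\<phi> (inv g) x)) = 0" if "g \<in> carrier G" for g
    using sum.reindex_bij_betw[OF bij_betw_action, of "inv g" f] that sum0 by simp
  have "(\<Sum>x\<in>E. c x) = (\<Sum>g\<in>carrier G. \<mu> g * (\<Sum>x\<in>E. f (\<phi> (inv g) x)))"
    unfolding c_def conv_def sum_distrib_left by (rule sum.swap)
  then have "(\<Sum>x\<in>E. c x) = 0" using sum_shift by simp
  then have w: "w \<in> zero_sum_space E"
    by (simp add: w_def zero_sum_space_def perm_space_def flip: of_real_sum)
  have v: "v \<in> zero_sum_space E"
    using sum0 by (simp add: v_def zero_sum_space_def perm_space_def flip: of_real_sum)
  have sv: "sqnorm E v = (L2_set f E)\<^sup>2" and sw: "sqnorm E w = (L2_set c E)\<^sup>2"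
    by (simp_all add: sqnorm_def v_def w_def L2)
  have t: "cip E (perm_rep G E \<phi> g v) w = of_real (t g)" if "g \<in> carrier G" for g
  proof -
    have "\<phi> (inv g) x \<in> E" if "x \<in> E" for x
      using that \<open>g \<in> carrier G\<close> element_image by blast
    then show ?thesis
      by (simp add: cip_def perm_rep_def v_def w_def t_def)
  qed
  have energy: "coeff_energy G E \<phi> v w = (\<Sum>g\<in>carrier G. (t g)\<^sup>2)"
    by (simp add: coeff_energy_def t)
  \<comment> \<open>Only one of the two factors \<open>c x\<close> is expanded as a convolution; the
    other one pairs with the translates of \<open>f\<close> to form \<open>t\<close>.\<close>
  have "(L2_set c E)\<^sup>2 = (\<Sum>x\<in>E. \<Sum>g\<in>carrier G. \<mu> g * (f (\<phi> (inv g) x) * c x))"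
    unfolding L2
  proof (rule sum.cong[OF refl])
    fix x
    have "(c x)\<^sup>2 = (\<Sum>g\<in>carrier G. \<mu> g * f (\<phi> (inv g) x)) * c x"
      by (simp add: power2_eq_square c_def conv_def)
    then show "(c x)\<^sup>2 = (\<Sum>g\<in>carrier G. \<mu> g * (f (\<phi> (inv g) x) * c x))"
      by (simp only: sum_distrib_right mult.assoc)
  qed
  also have "\<dots> = (\<Sum>g\<in>carrier G. \<mu> g * t g)"
    unfolding t_def sum_distrib_left by (rule sum.swap)
  finally have c_norm: "(L2_set c E)\<^sup>2 = (\<Sum>g\<in>carrier G. \<mu> g * t g)" .
  have CS: "((L2_set c E)\<^sup>2)\<^sup>2 \<le> (L2_set \<mu> (carrier G))\<^sup>2 * coeff_energy G E \<phi> v w"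
    unfolding c_norm unfolding energy L2 by (rule Cauchy_Schwarz_ineq_sum)
  show ?thesis
  \<comment> \<open>In the degenerate case the left side is 0, whatever the quotient on the right
    is. Otherwise \<open>v\<close> witnesses a positive minimal degree, and the norm of
    \<open>c\<close> may be cancelled.\<close>
  proof (cases "v = 0 \<or> L2_set c E = 0")
    case True
    have "L2_set c E = 0"
    proof (rule ccontr)
      assume "L2_set c E \<noteq> 0"
      with True have "v = 0" by blast
      then have "perm_rep G E \<phi> g v = (\<lambda>x. 0)" for g
        by (simp add: perm_rep_def fun_eq_iff)
      then have "coeff_energy G E \<phi> v w = 0" by (simp add: coeff_energy_def cip_def)
      then show False using CS \<open>L2_set c E \<noteq> 0\<close> by simp
    qed
    then show ?thesis by (simp add: c_def)
  next
    case False
    let ?d = "real (min_degree G E \<phi>)"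
    have d: "0 < ?d"
      using coeff_energy_le(1)[OF finE v] False by simp
    have "?d * ((L2_set c E)\<^sup>2)\<^sup>2 \<le> (L2_set \<mu> (carrier G))\<^sup>2 * (?d * coeff_energy G E \<phi> v w)"
      using mult_left_mono[OF CS, of ?d] d by (simp add: mult_ac)
    also have "\<dots> \<le> (L2_set \<mu> (carrier G))\<^sup>2 * (real (order G) * (L2_set f E)\<^sup>2 * (L2_set c E)\<^sup>2)"
      using coeff_energy_le(2)[OF finE v _ w, of v] False
      by (intro mult_left_mono) (simp_all add: sv sw)
    finally have "(?d * (L2_set c E)\<^sup>2) * (L2_set c E)\<^sup>2
        \<le> (real (order G) * (L2_set \<mu> (carrier G))\<^sup>2 * (L2_set f E)\<^sup>2) * (L2_set c E)\<^sup>2"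
      by (simp add: mult_ac power2_eq_square)
    then have "?d * (L2_set c E)\<^sup>2 \<le> real (order G) * (L2_set \<mu> (carrier G))\<^sup>2 * (L2_set f E)\<^sup>2"
      using False by (simp add: mult_le_cancel_right)
    then show ?thesis
      using d by (simp add: c_def field_simps)
  qed
qed

end

section \<open>The coset action and transfer to it\<close>

text \<open>The pointwise laws make the inverse element act as the inverse map, which gives
  bijectivity; extensionality is part of membership in \<open>Bij E\<close> and turns the pointwise
  product law into an equality of maps.\<close>

lemma group_actionI:
  assumes "group G"
    and ext: "\<And>g. g \<in> carrier G \<Longrightarrow> \<phi> g \<in> extensional E"
    and closed: "\<And>g x. g \<in> carrier G \<Longrightarrow> x \<in> E \<Longrightarrow> \<phi> g x \<in> E"
    and one: "\<And>x. x \<in> E \<Longrightarrow> \<phi> \<one>\<^bsub>G\<^esub> x = x"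
    and mult: "\<And>g h x. g \<in> carrier G \<Longrightarrow> h \<in> carrier G \<Longrightarrow> x \<in> E
                 \<Longrightarrow> \<phi> (g \<otimes>\<^bsub>G\<^esub> h) x = \<phi> g (\<phi> h x)"
  shows "group_action G E \<phi>"
proof -
  interpret group G by fact
  have inverse: "\<phi> (inv\<^bsub>G\<^esub> g) (\<phi> g x) = x" "\<phi> g (\<phi> (inv\<^bsub>G\<^esub> g) x) = x"
    if "g \<in> carrier G" "x \<in> E" for g x
    using that one mult[of "inv\<^bsub>G\<^esub> g" g x] mult[of g "inv\<^bsub>G\<^esub> g" x] by simp_all
  have "bij_betw (\<phi> g) E E" if g: "g \<in> carrier G" for g
    by (rule bij_betw_byWitness[where f' = "\<phi> (inv\<^bsub>G\<^esub> g)"])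
      (use g inverse closed in auto)
  then have Bij: "\<phi> g \<in> Bij E" if "g \<in> carrier G" for g
    using that ext by (simp add: Bij_def)
  have "\<phi> (g \<otimes>\<^bsub>G\<^esub> h) = compose E (\<phi> g) (\<phi> h)"
    if "g \<in> carrier G" "h \<in> carrier G" for g h
    using that ext mult by (intro extensionalityI[of _ E]) (auto simp: compose_def)
  then have "\<phi> \<in> hom G (BijGroup E)"
    using Bij by (auto simp: hom_def BijGroup_def)
  then show ?thesis
    using group_axioms group_BijGroup
    by (simp add: group_action_def group_hom_def group_hom_axioms_def)
qed

lemma transitive_coset_action:
  assumes "group G" "subgroup H G"
  shows "transitive_action G (lcosets\<^bsub>G\<^esub> H) (coset_action G H)"
proof -
  interpret group G by fact
  have H: "H \<subseteq> carrier G" using assms(2) by (rule subgroup.subset)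
  have act: "coset_action G H g (k <#\<^bsub>G\<^esub> H) = (g \<otimes>\<^bsub>G\<^esub> k) <#\<^bsub>G\<^esub> H"
    if "g \<in> carrier G" "k \<in> carrier G" for g k
    using that H by (auto simp: coset_action_def LCOSETS_def lcos_m_assoc)
  have "group_action G (lcosets\<^bsub>G\<^esub> H) (coset_action G H)"
  proof (rule group_actionI)
    show "coset_action G H g \<in> extensional (lcosets\<^bsub>G\<^esub> H)" for g
      by (simp add: coset_action_def)
  qed (auto simp: LCOSETS_def act m_assoc intro: group_axioms)
  moreover have "\<exists>g\<in>carrier G. coset_action G H g C = D"
    if CD: "C \<in> lcosets\<^bsub>G\<^esub> H" "D \<in> lcosets\<^bsub>G\<^esub> H" for C D
  proof -
    obtain a b where ab: "a \<in> carrier G" "b \<in> carrier G" "C = a <#\<^bsub>G\<^esub> H" "D = b <#\<^bsub>G\<^esub> H"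
      using CD by (auto simp: LCOSETS_def)
    \<comment> \<open>The element \<open>b\<close> times the inverse of \<open>a\<close> carries the
      coset of \<open>a\<close> to that of \<open>b\<close>.\<close>
    then have "coset_action G H (b \<otimes>\<^bsub>G\<^esub> inv\<^bsub>G\<^esub> a) C = D"
      by (simp add: act m_assoc)
    then show ?thesis using ab by blast
  qed
  ultimately show ?thesis
    by (simp add: transitive_action_def transitive_action_axioms_def)
qed

text \<open>The orbit-stabilizer correspondence, sending the coset of \<open>k\<close> to
  \<open>\<phi> k \<omega>\<close>. It links the given action to the coset action, on which the
  degree is defined.\<close>

lemma (in transitive_action) coset_action_equivalence:
  assumes "\<omega> \<in> E" and H: "H = stabilizer G \<phi> \<omega>"
  shows "\<exists>\<beta>. bij_betw \<beta> (lcosets H) E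
           \<and> (\<forall>g\<in>carrier G. \<forall>C\<in>lcosets H. \<beta> (coset_action G H g C) = \<phi> g (\<beta> C))"
proof -
  interpret group G by (rule group_G)
  \<comment> \<open>The chosen representative does not matter, because \<open>H\<close> fixes
    \<open>\<omega>\<close>.\<close>
  define \<beta> where "\<beta> C = \<phi> (SOME g. g \<in> C) \<omega>" for C
  have subH: "subgroup H G" using stabilizer_subgroup assms by simp
  have \<beta>: "\<beta> (k <# H) = \<phi> k \<omega>" if k: "k \<in> carrier G" for k
  proof -
    have "(SOME g. g \<in> k <# H) \<in> k <# H"
      using lcos_self[OF k subH] by (rule someI)
    then obtain h where "h \<in> H" "(SOME g. g \<in> k <# H) = k \<otimes> h"
      by (auto simp: l_coset_def)
    then show ?thesis
      using k assms by (simp add: \<beta>_def stabilizer_def composition_rule)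
  qed
  have "inj_on \<beta> (lcosets H)"
  proof (rule inj_onI)
    fix C D assume CD: "C \<in> lcosets H" "D \<in> lcosets H" "\<beta> C = \<beta> D"
    then obtain a b where ab: "a \<in> carrier G" "b \<in> carrier G" "C = a <# H" "D = b <# H"
      by (auto simp: LCOSETS_def)
    then have "\<phi> a \<omega> = \<phi> b \<omega>" using CD(3) \<beta> by simp
    \<comment> \<open>Equal images place \<open>inv a \<otimes> b\<close> in the stabilizer
      \<open>H\<close>, hence \<open>b\<close> in the coset of \<open>a\<close>.\<close>
    then have "\<phi> (inv a \<otimes> b) \<omega> = \<omega>"
      using ab assms(1) orbit_sym_aux[of a \<omega> "\<phi> b \<omega>"] by (simp add: composition_rule)
    then have "inv a \<otimes> b \<in> H" using ab by (simp add: H stabilizer_def)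
    then have "a \<otimes> (inv a \<otimes> b) \<in> a <# H" by (auto simp: l_coset_def)
    then have "b \<in> a <# H" using ab by (simp flip: m_assoc)
    then show "C = D"
      using l_repr_independence[OF _ ab(1) subH] ab by simp
  qed
  moreover have "\<beta> ` (lcosets H) = E"
  proof
    show "\<beta> ` (lcosets H) \<subseteq> E"
      using element_image assms(1) by (auto simp: LCOSETS_def \<beta>)
    show "E \<subseteq> \<beta> ` (lcosets H)"
    proof
      fix x assume "x \<in> E"
      then obtain g where "g \<in> carrier G" "\<phi> g \<omega> = x"
        using unique_orbit assms(1) by blast
      then show "x \<in> \<beta> ` (lcosets H)"
        using \<beta> by (auto simp: LCOSETS_def image_iff)
    qed
  qed
  moreover have "\<beta> (coset_action G H g C) = \<phi> g (\<beta> C)"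
    if gC: "g \<in> carrier G" "C \<in> lcosets H" for g C
  proof -
    obtain k where k: "k \<in> carrier G" "C = k <# H"
      using gC(2) by (auto simp: LCOSETS_def)
    then have "coset_action G H g C = (g \<otimes> k) <# H"
      using gC subgroup.subset[OF subH] by (simp add: coset_action_def lcos_m_assoc)
    then show ?thesis
      using k gC(1) assms(1) by (simp add: \<beta> composition_rule)
  qed
  ultimately show ?thesis by (auto simp: bij_betw_def)
qed

lemma L2_set_reindex_bij_betw:
  "bij_betw \<beta> A B \<Longrightarrow> L2_set (\<lambda>x. h (\<beta> x)) A = L2_set h B"
  using sum.reindex_bij_betw[of \<beta> A B "\<lambda>y. (h y)\<^sup>2"] by (simp add: L2_set_def)

lemma min_nontrivial_degree_eq:
  "min_nontrivial_degree G H = min_degree G (lcosets\<^bsub>G\<^esub> H) (coset_action G H)"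
  by (simp add: min_nontrivial_degree_def min_degree_def irreducible_component_def Let_def conj_assoc)

theorem proposition1p4:
  fixes G :: "('g, 'm) monoid_scheme"
    and \<Omega> :: "'x set"
    and \<phi> :: "'g \<Rightarrow> 'x \<Rightarrow> 'x"
    and \<omega> :: 'x
    and H :: "'g set"
    and \<mu> :: "'g \<Rightarrow> real"
    and f :: "'x \<Rightarrow> real"
  assumes "finite (carrier G)"
    and "finite \<Omega>"
    and "transitive_action G \<Omega> \<phi>"
    and "card \<Omega> \<ge> 2"
    and "\<omega> \<in> \<Omega>"
    and "H = stabilizer G \<phi> \<omega>"
    and "prob_distribution (carrier G) \<mu>"
    and "(\<Sum>x\<in>\<Omega>. f x) = 0"
  shows "(L2_set (conv G \<phi> \<mu> f) \<Omega>)\<^sup>2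
    \<le> real (order G) / real (min_nontrivial_degree G H)
        * (L2_set \<mu> (carrier G))\<^sup>2 * (L2_set f \<Omega>)\<^sup>2"
proof -
  interpret transitive_action G \<Omega> \<phi> by fact
  interpret group G by (rule group_G)
  let ?E = "lcosets\<^bsub>G\<^esub> H" and ?\<psi> = "coset_action G H"
  have "subgroup H G" using stabilizer_subgroup assms(5,6) by simp
  then interpret cosets: transitive_action G ?E ?\<psi>
    by (rule transitive_coset_action[OF group_G])
  obtain \<beta> where \<beta>: "bij_betw \<beta> ?E \<Omega>"
    and equivariant: "\<And>g C. g \<in> carrier G \<Longrightarrow> C \<in> ?E \<Longrightarrow> \<beta> (?\<psi> g C) = \<phi> g (\<beta> C)"
    using coset_action_equivalence[OF assms(5,6)] by blast
  have "finite ?E" using bij_betw_finite[OF \<beta>] assms(2) by simp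
  moreover have "(\<Sum>C\<in>?E. f (\<beta> C)) = 0"
    using sum.reindex_bij_betw[OF \<beta>, of f] assms(8) by simp
  \<comment> \<open>The bound is applied to the pullback of \<open>f\<close> along
    \<open>\<beta>\<close>; equivariance makes convolution commute with this pullback, and the
    bijection preserves norms.\<close>
  ultimately have bound: "(L2_set (conv G ?\<psi> \<mu> (\<lambda>C. f (\<beta> C))) ?E)\<^sup>2
      \<le> real (order G) / real (min_degree G ?E ?\<psi>)
        * (L2_set \<mu> (carrier G))\<^sup>2 * (L2_set (\<lambda>C. f (\<beta> C)) ?E)\<^sup>2"
    by (rule cosets.conv_L2_bound[OF assms(1)])
  have "conv G ?\<psi> \<mu> (\<lambda>C. f (\<beta> C)) C = conv G \<phi> \<mu> f (\<beta> C)" if "C \<in> ?E" for C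
    using that by (simp add: conv_def equivariant)
  then have "L2_set (conv G ?\<psi> \<mu> (\<lambda>C. f (\<beta> C))) ?E = L2_set (\<lambda>C. conv G \<phi> \<mu> f (\<beta> C)) ?E"
    by (rule L2_set_cong[OF refl])
  then show ?thesis
    using bound
    by (simp only: L2_set_reindex_bij_betw[OF \<beta>] min_nontrivial_degree_eq)
qed

end
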